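(* Let $q=p^e>4$, where $p$ is a prime, and let $\ell$ be a positive integer with $2\ell\mid e$. Put $y=\frac{q-1}{p^\ell-1}$, let $m\mid(q-1)$ be a positive integer, and write $m_2=\gcd(m,y)$ and $m_1=\frac{m}{m_2}$. Let $n=rm$, where $1\le r\le\frac{p^\ell-1}{m_1}$, and let $s\ge1$. Then, for every integer $k$ with $s+1\le k\le\left\lfloor\frac{p^\ell+n}{p^\ell+1}\right\rfloor$ and every integer $h$ with $0\le h\le k-s-1$, there exists an $[n+s,k]_q$ generalized Roth-Lempel code $C$ such that $\dim\bigl(\operatorname{Hull}_{\ell}(C)\bigr)=h$.
   Context: For $q=p^e$ and $0\le\ell\le e-1$, the $\ell$-Galois inner product on $\mathbb F_q^N$ is $\langle\boldsymbol x,\boldsymbol y\rangle_\ell=\sum_i x_iy_i^{p^\ell}$. For a linear code $C\subseteq\mathbb F_q^N$, $C^{\perp_\ell}=\{\boldsymbol x\in\mathbb F_q^N:\langle\boldsymbol c,\boldsymbol x\rangle_\ell=0\ \text{for all }\boldsymbol c\in C\}$ and $\operatorname{Hull}_\ell(C)=C\cap C^{\perp_\ell}$. An $[n+s,k]_q$ generalized Roth-Lempel (GRL) code, where $1\le s\le k\le n$, is a code of the form $$\operatorname{GRL}_k(\boldsymbol a,\boldsymbol v,A_s)=\{(v_1f(a_1),\ldots,v_nf(a_n),(f_{k-s},\ldots,f_{k-1})A_s): f(x)=\textstyle\sum_{j=0}^{k-1}f_jx^j\in\mathbb F_q[x]\},$$ where $\boldsymbol a\in\mathbb F_q^n$ has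 pairwise distinct entries, $\boldsymbol v\in(\mathbb F_q^* )^n$ and $A_s\in\operatorname{GL}_s(\mathbb F_q)$. *)

theory Defs
  imports
    "HOL-Library.Cardinality"
    "HOL-Computational_Algebra.Primes"
    "HOL-Computational_Algebra.Polynomial"
    "Jordan_Normal_Form.VS_Connect"
begin

text \<open>Vectors are those of \<^typ>\<open>'a vec\<close>, indexed from 0; \<open>F\<^sub>q\<close> is a finite type of class
  \<^class>\<open>field\<close>. The set \<open>C\<close> is regarded below as a subspace of \<open>carrier_vec N\<close>.\<close>

definition code_dim :: "nat \<Rightarrow> 'a::field vec set \<Rightarrow> nat" where
  "code_dim N C = vectorspace.dim class_ring ((module_vec TYPE('a) N)\<lparr>carrier := C\<rparr>)"

definition linear_code :: "nat \<Rightarrow> nat \<Rightarrow> 'a::field vec set \<Rightarrow> bool" where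
  "linear_code N k C \<longleftrightarrow>
     VectorSpace.subspace class_ring C (module_vec TYPE('a) N) \<and> code_dim N C = k"

definition galois_inner :: "nat \<Rightarrow> nat \<Rightarrow> 'a::field vec \<Rightarrow> 'a vec \<Rightarrow> 'a" where
  "galois_inner p l x y = (\<Sum>i<dim_vec y. x $ i * (y $ i) ^ (p ^ l))"

definition galois_dual :: "nat \<Rightarrow> nat \<Rightarrow> nat \<Rightarrow> 'a::field vec set \<Rightarrow> 'a vec set" where
  "galois_dual p l N C = {x \<in> carrier_vec N. \<forall>c\<in>C. galois_inner p l c x = 0}"

definition galois_hull :: "nat \<Rightarrow> nat \<Rightarrow> nat \<Rightarrow> 'a::field vec set \<Rightarrow> 'a vec set" where
  "galois_hull p l N C = C \<inter> galois_dual p l N C"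

text \<open>The row vector \<open>(f\<^sub>k\<^sub>-\<^sub>s, \<dots>, f\<^sub>k\<^sub>-\<^sub>1) A\<close> is written as the transpose of \<open>A\<close> applied to a
  column vector. The condition \<open>degree f < k\<close> includes \<open>f = 0\<close> since \<open>k \<ge> 1\<close> wherever this
  is used.\<close>

definition GRL :: "nat \<Rightarrow> nat \<Rightarrow> nat \<Rightarrow> 'a::field vec \<Rightarrow> 'a vec \<Rightarrow> 'a mat \<Rightarrow> 'a vec set" where
  "GRL n s k a v A =
     {vec n (\<lambda>i. v $ i * poly f (a $ i))
        @\<^sub>v (transpose_mat A *\<^sub>v vec s (\<lambda>j. coeff f (k - s + j))) | f. degree f < k}"

definition is_GRL_code :: "nat \<Rightarrow> nat \<Rightarrow> nat \<Rightarrow> 'a::field vec set \<Rightarrow> bool" where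
  "is_GRL_code n s k C \<longleftrightarrow>
     1 \<le> s \<and> s \<le> k \<and> k \<le> n \<and>
     (\<exists>a v A. a \<in> carrier_vec n \<and> (\<forall>i<n. \<forall>j<n. i \<noteq> j \<longrightarrow> a $ i \<noteq> a $ j) \<and>
        v \<in> carrier_vec n \<and> (\<forall>i<n. v $ i \<noteq> 0) \<and>
        A \<in> carrier_mat s s \<and> invertible_mat A \<and>
        C = GRL n s k a v A)"

end

theory Submission
  imports Defs "HOL-Number_Theory.Residues"
begin

text \<open>Write \<open>Q = p ^ l\<close>. Take \<open>r\<close> distinct elements of \<open>F\<^sub>Q\<close> that are nonzero \<open>m\<close>-th powers in
  \<open>F\<^sub>q\<close>, and let \<open>S\<close> be the set of their \<open>n = r m\<close> \<open>m\<close>-th roots. Lagrange weights of these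
  elements together with 0 lie in \<open>F\<^sub>Q\<close> and pull back to weights \<open>w\<close> on \<open>S\<close> for which
  \<open>\<Sum>x\<in>S. w x * F x\<close> is a nonzero multiple of \<open>F 0\<close> whenever \<open>degree F < n\<close>. Since \<open>Q + 1\<close> divides
  \<open>(q - 1) / (Q - 1)\<close>, each \<open>w x\<close> is a \<open>(Q + 1)\<close>-th power \<open>v x ^ (Q + 1)\<close>. With multipliers \<open>v\<close> and
  \<open>A = 1\<close>, the Galois form of the codewords of \<open>f\<close> and \<open>g\<close> therefore reduces to a multiple of
  \<open>f 0 * g 0 ^ Q\<close> plus the contribution of the top \<open>s\<close> coefficients. Multiplying \<open>v x\<close> by some \<open>\<alpha>\<close>
  with \<open>\<alpha> ^ (Q + 1) \<noteq> 1\<close> adds a term in \<open>f x * g x ^ Q\<close> and so lowers the dimension of the hull by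
  one for each \<open>x\<close> chosen.\<close>

hide_const (open) up_ring.coeff up_ring.monom

section \<open>Linear codes as injective linear images\<close>

lemma linear_image_code:
  fixes F :: "'a::field vec \<Rightarrow> 'a vec"
  assumes carr: "\<And>x. x \<in> carrier_vec d \<Longrightarrow> F x \<in> carrier_vec N"
    and add: "\<And>x y. x \<in> carrier_vec d \<Longrightarrow> y \<in> carrier_vec d \<Longrightarrow> F (x + y) = F x + F y"
    and smult: "\<And>c x. x \<in> carrier_vec d \<Longrightarrow> F (c \<cdot>\<^sub>v x) = c \<cdot>\<^sub>v F x"
    and inj: "inj_on F (carrier_vec d)"
  shows "linear_code N d (F ` carrier_vec d)"
proof -
  let ?V = "module_vec TYPE('a) d" and ?W = "module_vec TYPE('a) N" and ?C = "F ` carrier_vec d"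
  \<comment> \<open>The codomain \<open>W\<close> stays open because \<open>F\<close> is used as a
    linear map twice: into the whole space, to see that its image is a subspace, and onto that
    image, to compare dimensions.\<close>
  have lm: "linear_map class_ring ?V W F"
    if "vectorspace class_ring W" "F \<in> LinearCombinations.module_hom class_ring ?V W" for W
    unfolding linear_map_def mod_hom_def mod_hom_axioms_def
    using that vec_vs[where n = d and 'a = 'a] by (simp add: vectorspace_def)
  have "F \<in> LinearCombinations.module_hom class_ring ?V ?W"
    by (simp add: LinearCombinations.module_hom_def carr add smult module_vec_simps)
  from lm[OF vec_vs this] have lmW: "linear_map class_ring ?V ?W F" .
  have sub: "VectorSpace.subspace class_ring ?C ?W"
    using linear_map.imT_is_subspace[OF lmW]
    by (simp add: mod_hom.im_def[OF linear_map.axioms(3)[OF lmW]] module_vec_simps)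
  have C: "vectorspace class_ring (?W\<lparr>carrier := ?C\<rparr>)"
    by (rule vectorspace.subspace_is_vs[OF vec_vs sub])
  have "F \<in> LinearCombinations.module_hom class_ring ?V (?W\<lparr>carrier := ?C\<rparr>)"
    by (simp add: LinearCombinations.module_hom_def add smult module_vec_simps)
  from lm[OF C this] have lmC: "linear_map class_ring ?V (?W\<lparr>carrier := ?C\<rparr>) F" .
  have "vectorspace.dim class_ring ?V = vectorspace.dim class_ring (?W\<lparr>carrier := ?C\<rparr>)"
    by (rule linear_map.dim_eq[OF lmC vec_space.fin_dim]) (simp_all add: inj module_vec_simps)
  thus ?thesis
    using sub by (simp add: linear_code_def code_dim_def vec_space.dim_is_n)
qed

text \<open>Coefficient vectors identify the polynomials of degree below \<open>d\<close> with
  \<open>carrier_vec d\<close>. Bounding coefficients instead of the degree makes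
  \<open>d = 0\<close> give the zero space, which is needed for a trivial hull.\<close>

lemma poly_image_code:
  fixes F :: "'a::field poly \<Rightarrow> 'a vec"
  assumes carr: "\<And>f. F f \<in> carrier_vec N"
    and add: "\<And>f g. F (f + g) = F f + F g"
    and smult: "\<And>c f. F (Polynomial.smult c f) = c \<cdot>\<^sub>v F f"
    and inj: "\<And>f. \<forall>i\<ge>d. coeff f i = 0 \<Longrightarrow> F f = 0\<^sub>v N \<Longrightarrow> f = 0"
  shows "linear_code N d (F ` {f. \<forall>i\<ge>d. coeff f i = 0})"
proof -
  define P :: "'a vec \<Rightarrow> 'a poly" where "P x = (\<Sum>i<d. monom (x $ i) i)" for x
  have coeff_P: "coeff (P x) i = (if i < d then x $ i else 0)" for x i
    by (simp add: P_def coeff_sum)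
  have img: "P ` carrier_vec d = {f. \<forall>i\<ge>d. coeff f i = 0}" (is "_ = ?R")
  proof (intro equalityI subsetI)
    fix f assume "f \<in> ?R"
    hence "f = P (vec d (coeff f))"
      by (intro poly_eqI) (auto simp: coeff_P)
    thus "f \<in> P ` carrier_vec d" by (rule image_eqI) simp
  qed (auto simp: coeff_P)
  have P_add: "P (x + y) = P x + P y" if "x \<in> carrier_vec d" "y \<in> carrier_vec d" for x y
    using that by (intro poly_eqI) (auto simp: coeff_P)
  have P_smult: "P (c \<cdot>\<^sub>v x) = Polynomial.smult c (P x)" if "x \<in> carrier_vec d" for x c
    using that by (intro poly_eqI) (auto simp: coeff_P)
  have "inj_on (F \<circ> P) (carrier_vec d)"
  proof (rule inj_onI)
    fix x y :: "'a vec"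
    assume x: "x \<in> carrier_vec d" and y: "y \<in> carrier_vec d" and eq: "(F \<circ> P) x = (F \<circ> P) y"
    have "F (P x + Polynomial.smult (-1) (P y)) = 0\<^sub>v N"
      using eq carr[of "P y"] unfolding add smult comp_def by auto
    hence "P x + Polynomial.smult (-1) (P y) = 0"
      by (intro inj) (auto simp: coeff_P)
    hence "coeff (P x) i = coeff (P y) i" for i
      by simp
    hence "x $ i = y $ i" if "i < d" for i
      using that coeff_P by metis
    thus "x = y" using x y by auto
  qed
  hence "linear_code N d ((F \<circ> P) ` carrier_vec d)"
    by (intro linear_image_code) (simp_all add: carr P_add add P_smult smult)
  thus ?thesis unfolding image_comp[symmetric] img .
qed

section \<open>A generator of the multiplicative group of a finite field\<close>

lemma class_ring_power: "x [^]\<^bsub>(class_ring :: 'a::field ring)\<^esub> (i::nat) = x ^ i"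
  by (induction i) (simp_all add: class_ring_simps)

lemma primitive_element_exists:
  "\<exists>g :: 'a::{field,finite}. g \<noteq> 0 \<and> (\<forall>x. x \<noteq> 0 \<longrightarrow> (\<exists>i. x = g ^ i))
     \<and> (\<forall>i. g ^ i = 1 \<longleftrightarrow> (CARD('a) - 1) dvd i)"
proof -
  have "finite (carrier (class_ring :: 'a ring))" by simp
  from field.finite_field_mult_group_has_gen[OF class_field this]
  obtain g :: 'a where g: "g \<noteq> 0" and gen: "UNIV - {0} = {g ^ i | i::nat. i \<in> UNIV}"
    by (auto simp: class_ring_power class_ring_simps)
  have "\<not> inj (\<lambda>i::nat. g ^ i)"
    using finite_imageD infinite_UNIV_nat by (metis finite)
  then obtain i j :: nat where "i < j" "g ^ i = g ^ j"
    by (metis injI linorder_neqE_nat)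
  hence "g ^ (j - i) = 1 \<and> 0 < j - i"
    using g by (simp add: power_diff)
  hence ex: "\<exists>m>0. g ^ m = 1" by blast
  define M where "M = (LEAST m. 0 < m \<and> g ^ m = 1)"
  have M: "0 < M" "g ^ M = 1" and M_le: "\<And>m. 0 < m \<Longrightarrow> g ^ m = 1 \<Longrightarrow> M \<le> m"
    using LeastI_ex[of "\<lambda>m. 0 < m \<and> g ^ m = 1"] ex Least_le[of "\<lambda>m. 0 < m \<and> g ^ m = 1"]
    unfolding M_def by blast+
  have mod: "g ^ i = g ^ (i mod M)" for i
  proof -
    have "g ^ i = g ^ (M * (i div M) + i mod M)" by simp
    also have "\<dots> = g ^ (i mod M)"
      unfolding power_add power_mult M(2) by simp
    finally show ?thesis .
  qed
  have "inj_on (\<lambda>i. g ^ i) {..<M}"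
  proof (rule linorder_inj_onI)
    fix i j assume "i < j" "i \<in> {..<M}" "j \<in> {..<M}"
    thus "g ^ i \<noteq> g ^ j"
      using M_le[of "j - i"] g by (auto simp: power_diff)
  qed auto
  moreover have "(\<lambda>i. g ^ i) ` {..<M} = UNIV - {0}"
    unfolding gen using mod M(1) by (auto simp: image_iff) (meson lessThan_iff mod_less_divisor)
  \<comment> \<open>The powers with exponent below the order \<open>M\<close> are distinct and run
    through all nonzero elements, so \<open>M\<close> counts them.\<close>
  ultimately have "M = card (UNIV - {0 :: 'a})"
    by (metis card_image card_lessThan)
  hence M_eq: "M = CARD('a) - 1" by (simp add: card_Diff_subset)
  have "g ^ i = 1 \<longleftrightarrow> CARD('a) - 1 dvd i" for i
    unfolding M_eq[symmetric]
    using mod[of i] M_le[of "i mod M"] M(1) mod_less_divisor[of M i]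
    by (metis dvd_eq_mod_eq_0 not_gr_zero not_le power_0)
  moreover have "\<exists>i. x = g ^ i" if "x \<noteq> 0" for x
  proof -
    have "x \<in> UNIV - {0}" using that by simp
    thus ?thesis unfolding gen by blast
  qed
  ultimately show ?thesis using g by (intro exI[of _ g]) simp
qed

section \<open>Lagrange weights and power sums\<close>

lemma sum_power_lagrange:
  fixes T :: "'a::field set"
  assumes fin: "finite T" and i: "Suc i < card T"
  shows "(\<Sum>b\<in>T. b ^ i * (\<Prod>c\<in>T - {b}. inverse (b - c))) = 0"
proof -
  define N where "N b = (\<Prod>c\<in>T - {b}. [:- c, 1:])" for b
  define u where "u b = (\<Prod>c\<in>T - {b}. inverse (b - c))" for b
  \<comment> \<open>This is the Lagrange interpolant of \<open>x ^ i\<close> on \<open>T\<close>. It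
    equals \<open>monom 1 i\<close> by uniqueness, and since \<open>i < card T - 1\<close> its
    coefficient at \<open>card T - 1\<close> vanishes. That coefficient is the sum in question, the
    \<open>N b\<close> being monic of that degree.\<close>
  define L where "L = (\<Sum>b\<in>T. Polynomial.smult (b ^ i * u b) (N b))"
  have monic: "lead_coeff (N b) = 1" for b
    unfolding N_def by (simp add: lead_coeff_prod)
  have deg: "degree (N b) = card T - 1" if "b \<in> T" for b
    unfolding N_def using that fin by (subst degree_prod_eq_sum_degree) (auto simp: card_Diff_singleton)
  have poly_N: "poly (N b) x = (if x = b then inverse (u b) else 0)" if "x \<in> T" for b x
    using that fin
    by (auto simp: N_def u_def poly_prod prod_inversef[symmetric] intro!: prod_zero bexI[of _ x])
  have u0: "u b \<noteq> 0" for b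
    using fin by (auto simp: u_def)
  have "poly L x = poly (monom 1 i) x" if "x \<in> T" for x
  proof -
    have "poly L x = (\<Sum>b\<in>T. if x = b then b ^ i else 0)"
      unfolding L_def poly_sum using that u0 by (intro sum.cong) (auto simp: poly_N)
    thus ?thesis using that fin by (simp add: poly_monom)
  qed
  moreover have "degree L \<le> card T - 1"
    unfolding L_def using deg fin by (intro degree_sum_le) (auto intro: order.trans[OF degree_smult_le])
  ultimately have "L = monom 1 i"
    using i by (intro poly_eqI_degree[of T]) (auto simp: degree_monom_eq)
  hence "coeff L (card T - 1) = 0"
    using i by simp
  moreover have "coeff L (card T - 1) = (\<Sum>b\<in>T. b ^ i * u b)"
  proof -
    have "coeff (N b) (card T - 1) = 1" if "b \<in> T" for b
      using monic[of b] deg[OF that] by simp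
    thus ?thesis
      unfolding L_def coeff_sum by simp
  qed
  ultimately show ?thesis by (simp add: u_def)
qed

section \<open>Degree bounds and polynomials with prescribed roots\<close>

lemma degree_less_iff_coeff:
  assumes "0 < k"
  shows "degree f < k \<longleftrightarrow> (\<forall>i\<ge>k. coeff f i = 0)"
  using assms by (metis coeff_eq_0 degree_lessI leD leI le_degree leading_coeff_0_iff order.strict_trans2)

lemma prod_linear_dvd:
  fixes f :: "'a::field poly"
  assumes "finite R" "\<And>c. c \<in> R \<Longrightarrow> poly f c = 0"
  shows "(\<Prod>c\<in>R. [:- c, 1:]) dvd f"
  using assms
proof (induction R arbitrary: f rule: finite_induct)
  case (insert x R)
  obtain g where g: "f = [:- x, 1:] * g"
    using insert.prems[of x] by (auto simp: poly_eq_0_iff_dvd dvd_def)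
  have "poly g c = 0" if "c \<in> R" for c
    using insert.prems[of c] insert.hyps that by (auto simp: g)
  hence "(\<Prod>c\<in>R. [:- c, 1:]) dvd g" by (rule insert.IH)
  thus ?case
    unfolding g prod.insert[OF insert.hyps] by (rule mult_dvd_mono[OF dvd_refl])
qed simp

lemma degree_prod_linear:
  "finite R \<Longrightarrow> degree (\<Prod>c\<in>R. [:- c, 1 :: 'a::field:]) = card R"
  by (subst degree_prod_eq_sum_degree) auto

section \<open>Codewords for the identity matrix, and their hulls\<close>

definition GRL_word :: "nat \<Rightarrow> nat \<Rightarrow> nat \<Rightarrow> (nat \<Rightarrow> 'a::field) \<Rightarrow> (nat \<Rightarrow> 'a) \<Rightarrow> 'a poly \<Rightarrow> 'a vec" where
  "GRL_word n s k a v f = vec n (\<lambda>i. v i * poly f (a i)) @\<^sub>v vec s (\<lambda>j. coeff f (k - s + j))"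

lemma GRL_one_mat:
  assumes "0 < k"
  shows "GRL n s k (vec n a) (vec n v) (1\<^sub>m s) = GRL_word n s k a v ` {f. \<forall>i\<ge>k. coeff f i = 0}"
proof -
  have "vec n (\<lambda>i. vec n v $ i * poly f (vec n a $ i)) = vec n (\<lambda>i. v i * poly f (a i))" for f
    by auto
  thus ?thesis
    unfolding GRL_def GRL_word_def degree_less_iff_coeff[OF assms]
    by (auto simp: transpose_one)
qed

lemma GRL_word_add: "GRL_word n s k a v (f + g) = GRL_word n s k a v f + GRL_word n s k a v g"
  unfolding GRL_word_def by (intro eq_vecI) (auto simp: algebra_simps)

lemma GRL_word_smult: "GRL_word n s k a v (Polynomial.smult c f) = c \<cdot>\<^sub>v GRL_word n s k a v f"
  unfolding GRL_word_def by (intro eq_vecI) (auto simp: algebra_simps)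

lemma GRL_word_carrier: "GRL_word n s k a v f \<in> carrier_vec (n + s)"
  by (auto simp: GRL_word_def)

text \<open>A nonzero polynomial of degree below \<open>k \<le> n\<close> cannot vanish at
  \<open>n\<close> distinct points, so the first \<open>n\<close> entries already determine
  \<open>f\<close>.\<close>

lemma GRL_word_eq_0:
  assumes "inj_on a {..<n}" "\<And>i. i < n \<Longrightarrow> v i \<noteq> 0" "k \<le> n"
    and "\<forall>i\<ge>k. coeff f i = 0" "GRL_word n s k a v f = 0\<^sub>v (n + s)"
  shows "f = 0"
proof (cases "k = 0")
  case False
  have "degree f < k"
    using assms(4) False degree_less_iff_coeff by blast
  moreover have "poly f (a i) = 0" if "i < n" for i
  proof -
    have "GRL_word n s k a v f $ i = 0" using assms(5) that by simp
    thus ?thesis using that assms(2) by (simp add: GRL_word_def)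
  qed
  moreover have "card (a ` {..<n}) = n"
    using assms(1) by (simp add: card_image)
  ultimately show ?thesis
    using assms(3) by (intro poly_eqI_degree[of "a ` {..<n}"]) auto
qed (use assms(4) in \<open>auto intro: poly_eqI\<close>)

lemma galois_inner_GRL_word:
  "galois_inner p l (GRL_word n s k a v f) (GRL_word n s k a v g) =
     (\<Sum>i<n. v i ^ (p ^ l + 1) * poly (f * g ^ (p ^ l)) (a i))
     + (\<Sum>j<s. coeff f (k - s + j) * coeff g (k - s + j) ^ (p ^ l))"
proof -
  let ?t = "\<lambda>i. GRL_word n s k a v f $ i * (GRL_word n s k a v g $ i) ^ (p ^ l)"
  have split: "(\<Sum>i<n + m. t i) = (\<Sum>i<n. t i) + (\<Sum>j<m. t (n + j))" for m and t :: "nat \<Rightarrow> 'a"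
    by (induction m) (simp_all add: add.assoc)
  have "galois_inner p l (GRL_word n s k a v f) (GRL_word n s k a v g) = (\<Sum>i<n + s. ?t i)"
    by (simp add: galois_inner_def GRL_word_def)
  also have "\<dots> = (\<Sum>i<n. ?t i) + (\<Sum>j<s. ?t (n + j))"
    by (rule split)
  finally show ?thesis
    by (simp add: GRL_word_def power_mult_distrib mult_ac)
qed

text \<open>By \<open>quad\<close> the Galois form becomes diagonal in the values on
  \<open>R\<close> and the top \<open>s\<close> coefficients. As \<open>card R \<le> k - s\<close>,
  these functionals can be tested one at a time. So the hull comes from the polynomials of degree
  below \<open>k - s\<close> that vanish on \<open>R\<close>, the multiples of the product of linear
  factors.\<close>

lemma galois_hull_GRL:
  fixes a v :: "nat \<Rightarrow> 'a::field" and \<Omega> :: "'a \<Rightarrow> 'a"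
  assumes s: "s \<le> k" and k: "0 < k"
    and R: "finite R" "card R \<le> k - s" and \<Omega>: "\<And>c. c \<in> R \<Longrightarrow> \<Omega> c \<noteq> 0" and Q: "0 < p ^ l"
    and quad: "\<And>F. degree F \<le> (k - 1) * (p ^ l + 1) \<Longrightarrow>
      (\<Sum>i<n. v i ^ (p ^ l + 1) * poly F (a i)) = (\<Sum>c\<in>R. \<Omega> c * poly F c)"
  shows "galois_hull p l (n + s) (GRL_word n s k a v ` {f. \<forall>i\<ge>k. coeff f i = 0}) =
    (\<lambda>f. GRL_word n s k a v ((\<Prod>c\<in>R. [:- c, 1:]) * f)) ` {f. \<forall>i\<ge>k - s - card R. coeff f i = 0}"
    (is "galois_hull _ _ _ (?W ` ?P) = _ ` ?H")
proof -
  define D where "D = (\<Prod>c\<in>R. [:- c, 1:])"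
  have degD: "degree D = card R" and D0: "D \<noteq> 0"
    using R(1) by (auto simp: D_def degree_prod_linear)
  have Q0: "(0::'a) ^ (p ^ l) = 0"
    using Q by (simp add: power_0_left)
  have inner: "galois_inner p l (?W f) (?W g) =
      (\<Sum>c\<in>R. \<Omega> c * (poly f c * poly g c ^ (p ^ l)))
      + (\<Sum>j<s. coeff f (k - s + j) * coeff g (k - s + j) ^ (p ^ l))"
    if f: "f \<in> ?P" and g: "g \<in> ?P" for f g
  \<comment> \<open>The bound in \<open>quad\<close> is exactly what the product
    \<open>f * g ^ (p ^ l)\<close> can reach when both degrees are at most
    \<open>k - 1\<close>.\<close>
  proof -
    have "degree f < k" "degree g < k"
      using f g by (simp_all add: degree_less_iff_coeff[OF k])
    hence deg: "degree f \<le> k - 1" "degree g \<le> k - 1" by simp_all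
    have "degree (f * g ^ (p ^ l)) \<le> degree f + degree (g ^ (p ^ l))"
      by (rule degree_mult_le)
    also have "\<dots> \<le> (k - 1) + (k - 1) * p ^ l"
      using deg by (intro add_mono order.trans[OF degree_power_le] mult_right_mono) auto
    finally have "degree (f * g ^ (p ^ l)) \<le> (k - 1) * (p ^ l + 1)"
      by (simp add: add_mult_distrib2 add.commute)
    from quad[OF this] show ?thesis
      unfolding galois_inner_GRL_word by simp
  qed
  have orth: "(\<forall>f\<in>?P. galois_inner p l (?W f) (?W g) = 0) \<longleftrightarrow>
      (\<forall>c\<in>R. poly g c = 0) \<and> (\<forall>j<s. coeff g (k - s + j) = 0)" if g: "g \<in> ?P" for g
  proof (intro iffI conjI)
    assume *: "\<forall>f\<in>?P. galois_inner p l (?W f) (?W g) = 0"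
    show roots: "\<forall>c\<in>R. poly g c = 0"
    proof
      fix c assume c: "c \<in> R"
      \<comment> \<open>This test polynomial isolates the value at \<open>c\<close>: it kills the
        other points of \<open>R\<close>, and its degree \<open>card R - 1\<close> is too small to
        reach the top \<open>s\<close> coefficients.\<close>
      define f where "f = (\<Prod>d\<in>R - {c}. [:- d, 1:])"
      have "degree f = card R - 1"
        using R c by (simp add: f_def degree_prod_linear card_Diff_singleton)
      moreover have "card R > 0"
        using R c by (auto simp: card_gt_0_iff)
      ultimately have "degree f < k - s"
        using R(2) by linarith
      hence top: "coeff f i = 0" if "i \<ge> k - s" for i
        using that by (intro coeff_eq_0) simp
      have "f \<in> ?P" using top by simp
      hence "(\<Sum>d\<in>R. \<Omega> d * (poly f d * poly g d ^ (p ^ l))) = 0"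
        using * inner[of f g] g top by simp
      moreover have "poly f d = 0" if "d \<in> R - {c}" for d
        using that R by (auto simp: f_def poly_prod intro!: prod_zero bexI[of _ d])
      ultimately have "\<Omega> c * (poly f c * poly g c ^ (p ^ l)) = 0"
        using R(1) c by (simp add: sum.remove[of R c])
      moreover have "poly f c \<noteq> 0"
        using R by (auto simp: f_def poly_prod)
      ultimately show "poly g c = 0" using \<Omega>[OF c] by simp
    qed
    show "\<forall>j<s. coeff g (k - s + j) = 0"
    proof (intro allI impI)
      fix j assume j: "j < s"
      \<comment> \<open>This monomial isolates one top coefficient. Its values on \<open>R\<close>
        do no harm because \<open>g\<close> is already known to vanish there.\<close>
      let ?f = "monom 1 (k - s + j) :: 'a poly"
      have "?f \<in> ?P" using j s by auto
      hence "(\<Sum>i<s. coeff ?f (k - s + i) * coeff g (k - s + i) ^ (p ^ l)) = 0"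
        using * inner[of ?f g] g roots Q0 by simp
      hence "(\<Sum>i<s. if j = i then coeff g (k - s + i) ^ (p ^ l) else 0) = 0"
        by (simp add: if_distrib[of "\<lambda>x. x * _"] cong: if_cong)
      thus "coeff g (k - s + j) = 0" using j by simp
    qed
  qed (use inner g Q0 in auto)
  have "galois_hull p l (n + s) (?W ` ?P) =
      ?W ` {g \<in> ?P. \<forall>f\<in>?P. galois_inner p l (?W f) (?W g) = 0}"
    by (auto simp: galois_hull_def galois_dual_def GRL_word_carrier)
  also have "{g \<in> ?P. \<forall>f\<in>?P. galois_inner p l (?W f) (?W g) = 0} =
      {g \<in> ?P. (\<forall>c\<in>R. poly g c = 0) \<and> (\<forall>j<s. coeff g (k - s + j) = 0)}"
    using orth by blast
  also have "\<dots> = {g. (\<forall>c\<in>R. poly g c = 0) \<and> (\<forall>i\<ge>k - s. coeff g i = 0)}"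
  proof -
    have "(\<forall>i\<ge>k - s. coeff g i = 0) \<longleftrightarrow> (\<forall>i\<ge>k. coeff g i = 0) \<and> (\<forall>j<s. coeff g (k - s + j) = 0)" for g :: "'a poly"
    proof (intro iffI allI impI)
      fix i assume *: "(\<forall>i\<ge>k. coeff g i = 0) \<and> (\<forall>j<s. coeff g (k - s + j) = 0)" and i: "k - s \<le> i"
      show "coeff g i = 0"
      proof (cases "i < k")
        case True
        hence "i - (k - s) < s" using i s by simp
        thus ?thesis using * i by (metis le_add_diff_inverse)
      qed (use * in simp)
    qed auto
    thus ?thesis by auto
  qed
  also have "\<dots> = (\<lambda>f. D * f) ` ?H"
  proof (intro equalityI subsetI)
    fix g assume g: "g \<in> {g. (\<forall>c\<in>R. poly g c = 0) \<and> (\<forall>i\<ge>k - s. coeff g i = 0)}"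
    hence "D dvd g"
      unfolding D_def using R(1) by (intro prod_linear_dvd) auto
    then obtain f where f: "g = D * f" by (auto simp: dvd_def)
    \<comment> \<open>Division by \<open>D\<close> lowers the degree by \<open>card R\<close>. The
      zero polynomial is treated apart, since its degree 0 does not obey that rule.\<close>
    have "coeff f i = 0" if "i \<ge> k - s - card R" for i
    proof (cases "f = 0")
      case False
      have "g \<noteq> 0" using False D0 f by simp
      hence "degree g < k - s"
        using g by (metis (mono_tags, lifting) leading_coeff_0_iff mem_Collect_eq not_le)
      moreover have "degree g = card R + degree f"
        using False D0 by (simp add: f degree_mult_eq degD)
      ultimately show ?thesis using that by (intro coeff_eq_0) linarith
    qed simp
    thus "g \<in> (\<lambda>f. D * f) ` ?H" using f by auto
  next
    fix g assume "g \<in> (\<lambda>f. D * f) ` ?H"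
    then obtain f where f: "g = D * f" and H: "f \<in> ?H" by auto
    have "poly D c = 0" if "c \<in> R" for c
      using that R(1) by (auto simp: D_def poly_prod intro!: prod_zero bexI[of _ c])
    moreover have "coeff g i = 0" if "i \<ge> k - s" for i
    proof (cases "f = 0")
      case False
      hence "degree f < k - s - card R"
        using H by (metis (mono_tags, lifting) leading_coeff_0_iff mem_Collect_eq not_le)
      moreover have "degree g = card R + degree f"
        using False D0 by (simp add: f degree_mult_eq degD)
      ultimately show ?thesis using that by (intro coeff_eq_0) linarith
    qed (simp add: f)
    ultimately show "g \<in> {g. (\<forall>c\<in>R. poly g c = 0) \<and> (\<forall>i\<ge>k - s. coeff g i = 0)}"
      by (simp add: f)
  qed
  finally show ?thesis
    by (simp add: image_image D_def)
qed

text \<open>Multiplication by the product over \<open>R\<close> followed by encoding is injective on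
  polynomials of degree below \<open>k - s - card R\<close>, because the products still have degree
  below \<open>k\<close>. Each point of \<open>R\<close> thus costs one dimension of the
  hull.\<close>

lemma GRL_with_hull_dim:
  fixes a v :: "nat \<Rightarrow> 'a::field" and \<Omega> :: "'a \<Rightarrow> 'a"
  assumes s: "1 \<le> s" "s \<le> k" and k: "k \<le> n"
    and a: "inj_on a {..<n}" and v: "\<And>i. i < n \<Longrightarrow> v i \<noteq> 0"
    and R: "finite R" "card R \<le> k - s" and \<Omega>: "\<And>c. c \<in> R \<Longrightarrow> \<Omega> c \<noteq> 0" and Q: "0 < p ^ l"
    and quad: "\<And>F. degree F \<le> (k - 1) * (p ^ l + 1) \<Longrightarrow>
      (\<Sum>i<n. v i ^ (p ^ l + 1) * poly F (a i)) = (\<Sum>c\<in>R. \<Omega> c * poly F c)"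
  shows "\<exists>C :: 'a vec set. linear_code (n + s) k C \<and> is_GRL_code n s k C \<and>
           code_dim (n + s) (galois_hull p l (n + s) C) = k - s - card R"
proof -
  define C where "C = GRL n s k (vec n a) (vec n v) (1\<^sub>m s)"
  define D where "D = (\<Prod>c\<in>R. [:- c, 1:])"
  have C: "C = GRL_word n s k a v ` {f. \<forall>i\<ge>k. coeff f i = 0}"
    unfolding C_def by (rule GRL_one_mat) (use s in simp)
  note eq_0 = GRL_word_eq_0[OF a v k]
  have "linear_code (n + s) k C"
    unfolding C
    by (rule poly_image_code) (auto simp: GRL_word_carrier GRL_word_add GRL_word_smult intro: eq_0)
  moreover have "is_GRL_code n s k C"
  proof -
    have "invertible_mat (1\<^sub>m s :: 'a mat)"
      by (auto simp: invertible_mat_def inverts_mat_def intro!: exI[of _ "1\<^sub>m s"])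
    moreover have "a i \<noteq> a j" if "i < n" "j < n" "i \<noteq> j" for i j
      using a that by (auto dest: inj_onD)
    ultimately show ?thesis
      unfolding is_GRL_code_def C_def using s k v
      by (intro conjI exI[where x = "vec n a"] exI[where x = "vec n v"] exI[where x = "1\<^sub>m s"]) auto
  qed
  moreover have "linear_code (n + s) (k - s - card R) (galois_hull p l (n + s) C)"
  proof -
    have hull: "galois_hull p l (n + s) C =
        (\<lambda>f. GRL_word n s k a v (D * f)) ` {f. \<forall>i\<ge>k - s - card R. coeff f i = 0}"
      unfolding C D_def using s by (intro galois_hull_GRL[OF _ _ R \<Omega> Q quad]) auto
    show ?thesis
      unfolding hull
    proof (rule poly_image_code)
      fix f
      assume f: "\<forall>i\<ge>k - s - card R. coeff f i = 0" and 0: "GRL_word n s k a v (D * f) = 0\<^sub>v (n + s)"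
      have "coeff (D * f) i = 0" if "i \<ge> k" for i
      proof (cases "f = 0")
        case False
        hence "degree f < k - s - card R"
          using f by (metis leading_coeff_0_iff not_le)
        moreover have "degree (D * f) \<le> card R + degree f"
          using degree_mult_le[of D f] R(1) by (simp add: D_def degree_prod_linear)
        ultimately show ?thesis using that by (intro coeff_eq_0) linarith
      qed simp
      hence "D * f = 0" using 0 by (intro eq_0) auto
      moreover have "D \<noteq> 0" using R(1) by (auto simp: D_def)
      ultimately show "f = 0" by simp
    qed (simp_all add: GRL_word_carrier GRL_word_add GRL_word_smult ring_distribs)
  qed
  ultimately show ?thesis unfolding linear_code_def by blast
qed

section \<open>Fibres of the \<open>m\<close>-th power map\<close>

lemma power_fibre:
  fixes \<beta> :: "'a::{field,finite}"
  assumes m: "0 < m" "m dvd CARD('a) - 1" and \<beta>: "\<beta> \<noteq> 0"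
  shows card_power_fibre: "card {x. x ^ m = \<beta> ^ m} = m"
    and sum_power_fibre: "(\<Sum>x | x ^ m = \<beta> ^ m. x ^ j) = (if m dvd j then of_nat m * \<beta> ^ j else 0)"
proof -
  obtain g :: 'a where g: "g \<noteq> 0" and gen: "\<And>x. x \<noteq> 0 \<Longrightarrow> \<exists>i. x = g ^ i"
    and ord: "\<And>i. g ^ i = 1 \<longleftrightarrow> (CARD('a) - 1) dvd i"
    using primitive_element_exists[where 'a = 'a] by blast
  obtain M where M: "CARD('a) - 1 = m * M" using m(2) by blast
  have "card {0, 1 :: 'a} \<le> CARD('a)" by (intro card_mono) auto
  hence "CARD('a) - 1 > 0" by simp
  hence M0: "M > 0" unfolding M by simp
  \<comment> \<open>A primitive \<open>m\<close>-th root of unity; the fibre over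
    \<open>\<beta> ^ m\<close> is the coset of its powers through \<open>\<beta>\<close>.\<close>
  define \<zeta> where "\<zeta> = g ^ M"
  have \<zeta>0: "\<zeta> \<noteq> 0" using g by (simp add: \<zeta>_def)
  have \<zeta>: "\<zeta> ^ i = 1 \<longleftrightarrow> m dvd i" for i
    unfolding \<zeta>_def power_mult[symmetric] ord M using M0 by (simp add: mult.commute)
  have bij: "bij_betw (\<lambda>i. \<beta> * \<zeta> ^ i) {..<m} {x. x ^ m = \<beta> ^ m}"
    unfolding bij_betw_def
  proof
    show "inj_on (\<lambda>i. \<beta> * \<zeta> ^ i) {..<m}"
    proof (rule linorder_inj_onI)
      fix i j assume ij: "i < j" "i \<in> {..<m}" "j \<in> {..<m}"
      hence "\<not> m dvd j - i" by (auto dest: dvd_imp_le)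
      hence "\<zeta> ^ (j - i) \<noteq> 1" using \<zeta> by simp
      thus "\<beta> * \<zeta> ^ i \<noteq> \<beta> * \<zeta> ^ j"
        using ij \<beta> \<zeta>0 by (simp add: power_diff)
    qed auto
    have \<zeta>m: "\<zeta> ^ m = 1" using \<zeta> by simp
    show "(\<lambda>i. \<beta> * \<zeta> ^ i) ` {..<m} = {x. x ^ m = \<beta> ^ m}"
    proof (intro equalityI subsetI)
      fix x assume "x \<in> (\<lambda>i. \<beta> * \<zeta> ^ i) ` {..<m}"
      then obtain i where "x = \<beta> * \<zeta> ^ i" by blast
      moreover have "(\<zeta> ^ i) ^ m = (\<zeta> ^ m) ^ i"
        by (simp add: power_mult[symmetric] mult.commute)
      ultimately show "x \<in> {x. x ^ m = \<beta> ^ m}"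
        by (simp add: power_mult_distrib \<zeta>m)
    next
      fix x assume "x \<in> {x. x ^ m = \<beta> ^ m}"
      hence x: "(x / \<beta>) ^ m = 1" using \<beta> by (simp add: power_divide)
      hence "x / \<beta> \<noteq> 0" using m(1) by (metis power_0_left less_irrefl zero_neq_one)
      then obtain i where i: "x / \<beta> = g ^ i" using gen by blast
      have "m * M dvd i * m"
        using x unfolding i power_mult[symmetric] ord M .
      hence "M dvd i" using m(1) by (simp add: mult.commute)
      then obtain i' where "i = M * i'" by blast
      hence "x / \<beta> = \<zeta> ^ i'" unfolding i \<zeta>_def by (simp add: power_mult)
      also have "\<dots> = \<zeta> ^ (m * (i' div m) + i' mod m)" by simp
      also have "\<dots> = \<zeta> ^ (i' mod m)"
        unfolding power_add power_mult \<zeta>m by simp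
      finally have "x = \<beta> * \<zeta> ^ (i' mod m)" using \<beta> by (simp add: field_simps)
      thus "x \<in> (\<lambda>i. \<beta> * \<zeta> ^ i) ` {..<m}" using m(1) by auto
    qed
  qed
  show "card {x. x ^ m = \<beta> ^ m} = m"
    using bij_betw_same_card[OF bij] by simp
  have "(\<Sum>x | x ^ m = \<beta> ^ m. x ^ j) = (\<Sum>i<m. (\<beta> * \<zeta> ^ i) ^ j)"
    by (rule sum.reindex_bij_betw[OF bij, symmetric])
  also have "\<dots> = \<beta> ^ j * (\<Sum>i<m. (\<zeta> ^ j) ^ i)"
    by (simp add: sum_distrib_left power_mult_distrib power_mult[symmetric] mult.commute)
  \<comment> \<open>A geometric sum over \<open>m\<close>-th roots of unity: it vanishes unless the
    ratio \<open>\<zeta> ^ j\<close> is 1.\<close>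
  also have "(\<Sum>i<m. (\<zeta> ^ j) ^ i) = (if m dvd j then of_nat m else 0)"
  proof (cases "m dvd j")
    case True
    hence "\<zeta> ^ j = 1" using \<zeta> by simp
    thus ?thesis using True by simp
  next
    case False
    hence "\<zeta> ^ j \<noteq> 1" using \<zeta> by simp
    moreover have "(\<zeta> ^ j) ^ m = 1"
      by (simp add: power_mult[symmetric] \<zeta>)
    ultimately show ?thesis using False by (simp add: geometric_sum)
  qed
  finally show "(\<Sum>x | x ^ m = \<beta> ^ m. x ^ j) = (if m dvd j then of_nat m * \<beta> ^ j else 0)"
    by simp
qed

section \<open>Evaluation points and weights\<close>

lemma CHAR_eq_of_CARD_eq_prime_power:
  assumes "prime p" "CARD('a::{field,finite}) = p ^ e"
  shows "CHAR('a) = p"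
proof -
  have "prime CHAR('a)"
    by (rule prime_CHAR_semidom, rule finite_imp_CHAR_pos) simp
  moreover have "CHAR('a) dvd p ^ e"
    using CHAR_dvd_CARD[where 'a = 'a] assms(2) by simp
  ultimately show ?thesis
    using assms(1) prime_dvd_power primes_dvd_imp_eq by blast
qed

lemma dvd_power_minus_one_nat: "x - 1 dvd x ^ t - (1::nat)"
proof (cases "x = 0")
  case False
  show ?thesis
  proof (induction t)
    case (Suc t)
    have "x ^ Suc t - 1 = x * (x ^ t - 1) + (x - 1)"
      using False by (simp add: diff_mult_distrib2)
    thus ?case using Suc by (metis dvd_add dvd_mult dvd_refl)
  qed simp
qed (cases t; simp)

text \<open>Summing \<open>x ^ j\<close> over a fibre of the \<open>m\<close>-th power map gives 0
  unless \<open>m\<close> divides \<open>j\<close>. The remaining exponents fall under the Lagrange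
  identity for \<open>r\<close> elements of the subfield of order \<open>p ^ l\<close> together with
  0. Weights in that subfield are norms, hence powers with exponent
  \<open>p ^ l + 1\<close>.\<close>

lemma GRL_points_exist:
  assumes p: "prime p" and card: "CARD('a::{field,finite}) = p ^ (2 * l * t)"
    and l: "0 < l" and t: "0 < t"
    and y: "y * (p ^ l - 1) = CARD('a) - 1"
    and m: "0 < m" "m dvd CARD('a) - 1"
    and r: "r \<le> (p ^ l - 1) div (m div gcd m y)" "0 < r"
  shows "\<exists>(S :: 'a set) w W. card S = r * m \<and> 0 \<notin> S \<and> W \<noteq> 0 \<and>
    (\<forall>x\<in>S. \<exists>v. v \<noteq> 0 \<and> v ^ (p ^ l + 1) = w x) \<and>
    (\<forall>F. degree F < r * m \<longrightarrow> (\<Sum>x\<in>S. w x * poly F x) = W * poly F 0)"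
proof -
  define Q where "Q = p ^ l"
  define N where "N = CARD('a) - 1"
  obtain g :: 'a where g: "g \<noteq> 0" and gen: "\<And>x. x \<noteq> 0 \<Longrightarrow> \<exists>i. x = g ^ i"
    and ord: "\<And>i. g ^ i = 1 \<longleftrightarrow> N dvd i"
    using primitive_element_exists[where 'a = 'a] unfolding N_def by blast
  have CHAR: "CHAR('a) = p"
    using p card by (rule CHAR_eq_of_CARD_eq_prime_power)
  have p2: "p \<ge> 2" using p by (rule prime_ge_2_nat)
  have Q2: "Q \<ge> 2"
    unfolding Q_def using p2 self_le_power[of p l] l by linarith
  have N: "N = y * (Q - 1)" unfolding N_def Q_def by (rule y[symmetric])
  have "card {0, 1 :: 'a} \<le> CARD('a)" by (intro card_mono) auto
  hence N0: "N > 0" by (simp add: N_def)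
  \<comment> \<open>The exponent of \<open>p\<close> being a multiple of \<open>2 * l\<close>,
    \<open>Q ^ 2 - 1\<close> divides \<open>N = y * (Q - 1)\<close>; the factor \<open>Q - 1\<close>
    cancels.\<close>
  have "Q + 1 dvd y"
  proof -
    have "Q ^ 2 - 1 dvd (Q ^ 2) ^ t - 1" by (rule dvd_power_minus_one_nat)
    also have "(Q ^ 2) ^ t - 1 = N"
      by (simp add: N_def card Q_def power_mult[symmetric] mult_ac)
    finally have "Q ^ 2 - 1 dvd y * (Q - 1)" unfolding N .
    moreover have "Q ^ 2 - 1 = (Q + 1) * (Q - 1)"
      by (simp add: power2_eq_square algebra_simps)
    ultimately have "(Q - 1) * (Q + 1) dvd (Q - 1) * y" by (metis mult.commute)
    moreover have "0 < Q - 1" using Q2 by simp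
    ultimately show ?thesis using nat_mult_dvd_cancel1 by blast
  qed
  then obtain c0 where c0: "y = (Q + 1) * c0" by blast
  define m2 where "m2 = gcd m y"
  define m1 where "m1 = m div m2"
  define y' where "y' = y div m2"
  have m2: "m2 > 0" using m by (simp add: m2_def)
  have m12: "m = m1 * m2" by (simp add: m1_def m2_def)
  have yy: "y = y' * m2" by (simp add: y'_def m2_def)
  have cop: "coprime m1 y'"
    unfolding m1_def y'_def m2_def using m by (intro div_gcd_coprime) auto
  have "m1 * m2 dvd (y' * (Q - 1)) * m2"
    using m(2) unfolding N_def[symmetric] N m12 yy by (simp add: mult_ac)
  hence "m1 dvd y' * (Q - 1)" using m2 by simp
  hence "m1 dvd Q - 1" using cop coprime_dvd_mult_right_iff by blast
  then obtain d where d: "Q - 1 = m1 * d" by blast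
  have m1: "m1 > 0" using m m12 by (cases m1) auto
  have rd: "r \<le> d"
    using r m1 d by (simp add: m1_def m2_def Q_def)
  have N': "N = y * m1 * d" unfolding N d by (simp only: mult.assoc)
  have ym: "y * m1 = y' * m" by (simp add: yy m12)
  have ym0: "y * m1 > 0" using N0 N' by (metis mult_is_0 neq0_conv)
  \<comment> \<open>The powers of \<open>g ^ y\<close> are the nonzero elements of the subfield of
    order \<open>Q\<close>. Those that are also \<open>m\<close>-th powers are generated by
    \<open>g ^ (y * m1)\<close>, as \<open>y * m1 = y' * m\<close> is the lcm of \<open>y\<close>
    and \<open>m\<close>. This element has order \<open>d\<close>, which leaves room for
    \<open>r \<le> d\<close> choices; \<open>\<beta> i\<close> is an explicit \<open>m\<close>-th
    root.\<close>
  define \<beta> where "\<beta> i = g ^ (y' * i)" for i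
  have \<beta>0: "\<beta> i \<noteq> 0" for i using g by (simp add: \<beta>_def)
  define b where "b i = \<beta> i ^ m" for i
  have b: "b i = g ^ (y * m1 * i)" for i
    unfolding b_def \<beta>_def ym power_mult[symmetric] by (simp only: mult_ac)
  have b0: "b i \<noteq> 0" for i using g by (simp add: b)
  have b_inj: "inj_on b {..<r}"
  proof (rule linorder_inj_onI)
    fix i j assume ij: "i < j" "i \<in> {..<r}" "j \<in> {..<r}"
    hence "\<not> d dvd j - i" using rd by (auto dest: dvd_imp_le)
    hence "\<not> N dvd y * m1 * (j - i)" unfolding N' using ym0 by simp
    hence "g ^ (y * m1 * j - y * m1 * i) \<noteq> 1" by (simp add: ord diff_mult_distrib2)
    moreover have "y * m1 * i \<le> y * m1 * j" using ij by simp
    ultimately show "b i \<noteq> b j"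
      using g by (simp add: b power_diff)
  qed auto
  define B where "B = b ` {..<r}"
  have B0: "0 \<notin> B" using b0 by (auto simp: B_def)
  have finB: "finite B" and cardB: "card B = r"
    using b_inj by (simp_all add: B_def card_image)
  \<comment> \<open>The subfield of order \<open>Q\<close>, as the fixed points of a power of
    Frobenius.\<close>
  define K where "K = {x :: 'a. x ^ Q = x}"
  have K_diff: "x - z \<in> K" if "x \<in> K" "z \<in> K" for x z
  proof -
    have "(x - z + z) ^ Q = (x - z) ^ Q + z ^ Q"
      using p CHAR by (intro freshmans_dream'[where n = l]) (simp_all add: Q_def)
    thus ?thesis using that by (simp add: K_def eq_diff_eq)
  qed
  have B_K: "B \<subseteq> K"
  proof
    fix x assume "x \<in> B"
    then obtain i where x: "x = g ^ (y * m1 * i)" by (auto simp: B_def b)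
    have "x ^ (Q - 1) = g ^ (N * (m1 * i))"
      by (simp add: x N power_mult[symmetric] mult_ac)
    also have "\<dots> = 1" by (simp add: ord)
    finally have "x ^ Suc (Q - 1) = x" by simp
    thus "x \<in> K" using Q2 by (simp add: K_def)
  qed
  \<comment> \<open>The extra node 0 carries the term that is later moved across the equation and
    becomes evaluation at 0.\<close>
  define T where "T = insert 0 B"
  have T_K: "T \<subseteq> K" using B_K Q2 by (auto simp: T_def K_def)
  have finT: "finite T" and cardT: "card T = Suc r"
    using finB cardB B0 by (simp_all add: T_def)
  define u where "u c = (\<Prod>c'\<in>T - {c}. inverse (c - c'))" for c
  have u0: "u c \<noteq> 0" for c using finT by (auto simp: u_def)
  have u_K: "u c \<in> K" if "c \<in> T" for c
  proof -
    have "(c - c') ^ Q = c - c'" if "c' \<in> T" for c'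
      using K_diff[of c c'] T_K \<open>c \<in> T\<close> that by (auto simp: K_def)
    thus ?thesis
      by (simp add: K_def u_def prod_power_distrib power_inverse)
  qed
  have u_norm: "\<exists>v. v \<noteq> 0 \<and> v ^ (Q + 1) = u c" if c: "c \<in> T" for c
  proof -
    obtain i where i: "u c = g ^ i" using gen[OF u0] by blast
    have "u c ^ Suc (Q - 1) = u c" using u_K[OF c] Q2 by (simp add: K_def)
    hence "u c ^ (Q - 1) = 1" using u0[of c] by simp
    \<comment> \<open>Membership in the subfield makes the exponent of \<open>g\<close> a multiple
      of \<open>y\<close>, hence of \<open>Q + 1\<close>.\<close>
    hence "y * (Q - 1) dvd i * (Q - 1)"
      unfolding i power_mult[symmetric] ord N .
    hence "y dvd i" using Q2 by simp
    then obtain i' where "i = (Q + 1) * c0 * i'" by (auto simp: c0)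
    hence "u c = (g ^ (c0 * i')) ^ (Q + 1)"
      unfolding i power_mult[symmetric] by (simp only: mult_ac)
    thus ?thesis using g by (metis power_not_zero)
  qed
  define S where "S = {x. x ^ m \<in> B}"
  define w where "w x = u (x ^ m)" for x
  \<comment> \<open>The sign comes from moving the node 0 to the other side, the factor
    \<open>m\<close> from the size of each fibre.\<close>
  define W where "W = - of_nat m * u 0"
  have fibre: "card {x. x ^ m = c} = m"
    "(\<Sum>x | x ^ m = c. x ^ j) = (if m dvd j then of_nat m * c ^ (j div m) else 0)" if cB: "c \<in> B" for c j
  proof -
    obtain i where c: "c = \<beta> i ^ m" using cB by (auto simp: B_def b_def)
    show "card {x. x ^ m = c} = m"
      unfolding c by (rule card_power_fibre[OF m \<beta>0])
    show "(\<Sum>x | x ^ m = c. x ^ j) = (if m dvd j then of_nat m * c ^ (j div m) else 0)"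
      unfolding c sum_power_fibre[OF m \<beta>0] by (simp add: power_mult[symmetric])
  qed
  \<comment> \<open>The codomain is left general so that summing the natural number 1 also yields
    the cardinality of \<open>S\<close>.\<close>
  have sum_S: "(\<Sum>x\<in>S. f x) = (\<Sum>c\<in>B. \<Sum>x | x ^ m = c. f x)" for f :: "'a \<Rightarrow> 'b::comm_monoid_add"
  proof -
    have "(\<Sum>c\<in>B. \<Sum>x | x \<in> S \<and> x ^ m = c. f x) = (\<Sum>x\<in>S. f x)"
      using finB by (intro sum.group) (auto simp: S_def)
    moreover have "{x. x \<in> S \<and> x ^ m = c} = {x. x ^ m = c}" if "c \<in> B" for c
      using that by (auto simp: S_def)
    ultimately show ?thesis by simp
  qed
  \<comment> \<open>There are \<open>r + 1\<close> nodes, so the identity reaches every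
    \<open>i < r\<close>. With \<open>0 ^ 0 = 1\<close> the node 0 contributes only at
    \<open>i = 0\<close>.\<close>
  have lagrange: "(\<Sum>c\<in>B. u c * c ^ i) = - u 0 * 0 ^ i" if "i < r" for i
  proof -
    have "(\<Sum>c\<in>T. c ^ i * u c) = 0"
      unfolding u_def using that by (intro sum_power_lagrange[OF finT]) (simp add: cardT)
    thus ?thesis
      unfolding T_def using finB B0 by (simp add: mult.commute eq_neg_iff_add_eq_0 add.commute)
  qed
  have power_sum: "(\<Sum>x\<in>S. w x * x ^ j) = W * 0 ^ j" if j: "j < r * m" for j
  proof -
    have "(\<Sum>x\<in>S. w x * x ^ j) = (\<Sum>c\<in>B. u c * (\<Sum>x | x ^ m = c. x ^ j))"
      unfolding sum_S w_def sum_distrib_left by (intro sum.cong refl) auto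
    also have "\<dots> = (\<Sum>c\<in>B. u c * (if m dvd j then of_nat m * c ^ (j div m) else 0))"
      by (intro sum.cong refl) (simp only: fibre)
    also have "\<dots> = (if m dvd j then of_nat m * (\<Sum>c\<in>B. u c * c ^ (j div m)) else 0)"
      by (simp add: sum_distrib_left mult_ac)
    also have "\<dots> = W * 0 ^ j"
    proof (cases "m dvd j")
      case True
      have "j div m < r" using j by (simp add: less_mult_imp_div_less)
      moreover have "(0::'a) ^ (j div m) = 0 ^ j"
        using True m(1) by (auto simp: power_0_left dvd_def)
      ultimately show ?thesis using True by (simp add: lagrange W_def)
    next
      case False
      hence "j \<noteq> 0" by (metis dvd_0_right)
      thus ?thesis using False by simp
    qed
    finally show ?thesis .
  qed
  have "card S = r * m"
    using sum_S[of "\<lambda>_. 1 :: nat"] fibre(1) cardB by simp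
  moreover have "0 \<notin> S"
    using B0 m(1) by (simp add: S_def power_0_left)
  moreover have "W \<noteq> 0"
  proof -
    \<comment> \<open>Otherwise the factor \<open>m\<close> in \<open>W\<close> would vanish in the
      field; but \<open>m\<close> divides \<open>q - 1\<close> while \<open>p\<close> divides
      \<open>q\<close>.\<close>
    have "\<not> p dvd m"
    proof
      assume "p dvd m"
      hence "p dvd CARD('a) - 1" using m(2) dvd_trans by blast
      moreover have "p dvd CARD('a)" using l t by (simp add: card)
      ultimately have "p dvd CARD('a) - (CARD('a) - 1)" by (rule dvd_diff_nat[rotated])
      thus False using p2 by simp
    qed
    thus ?thesis using u0[of 0] CHAR by (simp add: W_def of_nat_eq_0_iff_char_dvd)
  qed
  moreover have "\<exists>v. v \<noteq> 0 \<and> v ^ (Q + 1) = w x" if "x \<in> S" for x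
    using that u_norm by (simp add: S_def w_def T_def)
  moreover have "(\<Sum>x\<in>S. w x * poly F x) = W * poly F 0" if F: "degree F < r * m" for F
  proof -
    have "(\<Sum>x\<in>S. w x * poly F x) = (\<Sum>i\<le>degree F. coeff F i * (\<Sum>x\<in>S. w x * x ^ i))"
      unfolding poly_altdef sum_distrib_left by (subst sum.swap) (simp add: mult_ac)
    also have "\<dots> = (\<Sum>i\<le>degree F. coeff F i * (W * 0 ^ i))"
      using F by (intro sum.cong refl) (simp add: power_sum)
    also have "\<dots> = W * poly F 0"
      unfolding poly_altdef sum_distrib_left by (simp add: mult_ac)
    finally show ?thesis .
  qed
  ultimately show ?thesis unfolding Q_def by blast
qed

section \<open>Choice of multipliers and the prescribed hull dimension\<close>

theorem mainTheorem9:
  fixes p e l q y m m1 m2 n r s k h :: nat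
  assumes "prime p"
    and "q = p ^ e"
    and "q > 4"
    and "CARD('a::{field,finite}) = q"
    and "l > 0"
    and "2 * l dvd e"
    and "y = (q - 1) div (p ^ l - 1)"
    and "m > 0"
    and "m dvd q - 1"
    and "m2 = gcd m y"
    and "m1 = m div m2"
    and "n = r * m"
    and "1 \<le> r"
    and "r \<le> (p ^ l - 1) div m1"
    and "s \<ge> 1"
    and "s + 1 \<le> k"
    and "k \<le> (p ^ l + n) div (p ^ l + 1)"
    and "h \<le> k - s - 1"
  shows "\<exists>C :: 'a vec set.
           linear_code (n + s) k C \<and> is_GRL_code n s k C \<and>
           code_dim (n + s) (galois_hull p l (n + s) C) = h"
proof -
  define Q where "Q = p ^ l"
  obtain t where t: "e = 2 * l * t" using assms(6) by blast
  have t0: "t > 0" using assms(2,3) t by (cases t) auto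
  have Q2: "Q \<ge> 2"
    unfolding Q_def using prime_ge_2_nat[OF assms(1)] self_le_power[of p l] assms(5) by linarith
  have q: "q = (Q ^ 2) ^ t"
    by (simp add: assms(2) t Q_def power_mult[symmetric] mult_ac)
  have "Q - 1 dvd q - 1"
    using dvd_power_minus_one_nat[of Q "2 * t"] by (simp add: q power_mult)
  hence y: "y * (p ^ l - 1) = CARD('a) - 1"
    by (simp add: assms(4,7) Q_def)
  have "\<exists>(S :: 'a set) w W. card S = r * m \<and> 0 \<notin> S \<and> W \<noteq> 0 \<and>
      (\<forall>x\<in>S. \<exists>v. v \<noteq> 0 \<and> v ^ (p ^ l + 1) = w x) \<and>
      (\<forall>F. degree F < r * m \<longrightarrow> (\<Sum>x\<in>S. w x * poly F x) = W * poly F 0)"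
  proof (rule GRL_points_exist[OF assms(1) _ assms(5) t0 y assms(8)])
    show "CARD('a) = p ^ (2 * l * t)" using assms(2,4) t by simp
    show "m dvd CARD('a) - 1" using assms(4,9) by simp
    show "r \<le> (p ^ l - 1) div (m div gcd m y)" using assms(14) unfolding assms(10,11) .
  qed (use assms(13) in simp)
  then obtain S :: "'a set" and w W where S: "card S = n" "0 \<notin> S" and W: "W \<noteq> 0"
    and norm: "\<And>x. x \<in> S \<Longrightarrow> \<exists>v. v \<noteq> 0 \<and> v ^ (Q + 1) = w x"
    and sums: "\<And>F. degree F < n \<Longrightarrow> (\<Sum>x\<in>S. w x * poly F x) = W * poly F 0"
    unfolding assms(12) Q_def by blast
  obtain v0 where v0: "\<And>x. x \<in> S \<Longrightarrow> v0 x \<noteq> 0 \<and> v0 x ^ (Q + 1) = w x"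
    using norm by metis
  have w0: "w x \<noteq> 0" if "x \<in> S" for x
    using v0[OF that] by (metis power_not_zero)
  \<comment> \<open>This guarantees an \<open>\<alpha>\<close> whose norm is not 1. The assumption
    \<open>q > 4\<close> excludes \<open>Q = 2\<close>, \<open>q = 4\<close>, where every nonzero
    element has norm 1.\<close>
  have "Q + 1 < q - 1"
  proof (cases "Q = 2")
    case True
    thus ?thesis using assms(3) by simp
  next
    case False
    hence "3 * Q \<le> Q ^ 2" using Q2 by (simp add: power2_eq_square)
    moreover have "Q ^ 2 \<le> q"
      unfolding q using t0 Q2 by (intro self_le_power) auto
    ultimately show ?thesis using False Q2 by linarith
  qed
  hence "\<not> (CARD('a) - 1) dvd Q + 1"
    by (auto simp: assms(4) dest: dvd_imp_le)
  then obtain \<alpha> :: 'a where \<alpha>: "\<alpha> \<noteq> 0" "\<alpha> ^ (Q + 1) \<noteq> 1"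
    using primitive_element_exists[where 'a = 'a] by blast
  \<comment> \<open>The upper bound on \<open>k\<close> says precisely that
    \<open>(k - 1) * (Q + 1) \<le> n - 1\<close>, so the sum formula on \<open>S\<close> covers all
    products \<open>f * g ^ Q\<close>.\<close>
  have "k * (Q + 1) \<le> Q + n"
    using assms(17) unfolding Q_def by (simp add: less_eq_div_iff_mult_less_eq)
  hence kn: "(k - 1) * (Q + 1) < n"
    using assms(16) by (cases k) auto
  hence "k - 1 < n"
    by (metis le_add2 le_less_trans mult.right_neutral mult_le_mono2)
  hence k_le: "k \<le> n" by simp
  have "k - 1 - s - h \<le> card S" using k_le S by simp
  \<comment> \<open>Together with the point 0 this gives \<open>k - s - h\<close> points, leaving a
    hull of dimension \<open>h\<close>.\<close>
  then obtain T where T: "T \<subseteq> S" "card T = k - 1 - s - h" "finite T"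
    using obtain_subset_with_card_n by metis
  obtain a where a: "bij_betw a {..<n} S"
    using ex_bij_betw_nat_finite[of S] S(1) by (auto simp: atLeast0LessThan)
  define \<mu> where "\<mu> x = (if x \<in> T then \<alpha> else 1)" for x
  define v where "v i = v0 (a i) * \<mu> (a i)" for i
  \<comment> \<open>At a point of \<open>T\<close> this is the excess of the rescaled weight
    \<open>w c * \<alpha> ^ (Q + 1)\<close> over \<open>w c\<close>. The case split is unambiguous
    since 0 is not in \<open>S\<close>.\<close>
  define \<Omega> where "\<Omega> c = (if c = 0 then W else w c * (\<alpha> ^ (Q + 1) - 1))" for c
  have T0: "0 \<notin> T" using S T by blast
  have aS: "a i \<in> S" if "i < n" for i
    using bij_betwE[OF a] that by simp
  have cardR: "card (insert 0 T) = k - s - h"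
    using T T0 assms(16,18) by simp
  have quad: "(\<Sum>i<n. v i ^ (Q + 1) * poly F (a i)) = (\<Sum>c\<in>insert 0 T. \<Omega> c * poly F c)"
    if F: "degree F \<le> (k - 1) * (Q + 1)" for F
  proof -
    have "(\<Sum>i<n. v i ^ (Q + 1) * poly F (a i)) = (\<Sum>x\<in>S. (v0 x * \<mu> x) ^ (Q + 1) * poly F x)"
      unfolding v_def by (rule sum.reindex_bij_betw[OF a])
    also have "\<dots> = (\<Sum>x\<in>S. w x * poly F x + (if x \<in> T then \<Omega> x * poly F x else 0))"
      using v0 S(2)
      by (intro sum.cong refl) (auto simp: \<mu>_def \<Omega>_def power_mult_distrib algebra_simps simp del: power_Suc)
    also have "\<dots> = W * poly F 0 + (\<Sum>x\<in>T. \<Omega> x * poly F x)"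
    proof -
      have "(\<Sum>x\<in>S. w x * poly F x) = W * poly F 0"
        using F kn by (intro sums) linarith
      moreover have "S \<inter> T = T" using T(1) by blast
      ultimately show ?thesis
        by (simp add: sum.distrib sum.If_cases Int_def[symmetric])
    qed
    finally show ?thesis using T T0 by (simp add: \<Omega>_def)
  qed
  have "\<exists>C :: 'a vec set. linear_code (n + s) k C \<and> is_GRL_code n s k C \<and>
      code_dim (n + s) (galois_hull p l (n + s) C) = k - s - card (insert 0 T)"
  proof (rule GRL_with_hull_dim)
    show "v i \<noteq> 0" if "i < n" for i
      using v0[OF aS[OF that]] \<alpha> by (simp add: v_def \<mu>_def)
    show "\<Omega> c \<noteq> 0" if "c \<in> insert 0 T" for c
      using that W w0 T \<alpha> by (auto simp: \<Omega>_def)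
    show "card (insert 0 T) \<le> k - s" by (simp add: cardR)
    show "inj_on a {..<n}" using a by (rule bij_betw_imp_inj_on)
    show "0 < p ^ l" using prime_gt_0_nat[OF assms(1)] by simp
    show "1 \<le> s" "s \<le> k" "k \<le> n" using assms(15,16) k_le by simp_all
    show "finite (insert 0 T)" using T(3) by simp
    show "(\<Sum>i<n. v i ^ (p ^ l + 1) * poly F (a i)) = (\<Sum>c\<in>insert 0 T. \<Omega> c * poly F c)"
      if "degree F \<le> (k - 1) * (p ^ l + 1)" for F
      using quad[of F] that unfolding Q_def .
  qed
  moreover have "k - s - card (insert 0 T) = h"
    using cardR assms(16,18) by simp
  ultimately show ?thesis by simp
qed

end
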